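(* Let $k$ be a positive integer. For all non-negative integers $n,r$ with $n\geq r$, $$M_{n-r}^{(k)}M_{n+r}^{(k)}-\left(M_n^{(k)}\right)^2=-(2^k)^{n-r}\left(M_{r}^{(k)}\right)^2 .$$
   Context: The Mersenne numbers $\{M_n\}_{n\ge 0}$ are defined by $M_0=0$, $M_1=1$, $M_{n+2}=3M_{n+1}-2M_n$, i.e. $M_n=2^n-1$. For a positive integer $k$, the higher order Mersenne numbers are $M_n^{(k)}=M_{kn}/M_k$ for $n=0,1,2,\dots$. *)

theory Defs
  imports Complex_Main
begin

fun mersenne :: "nat \<Rightarrow> int" where
  "mersenne 0 = 0"
| "mersenne (Suc 0) = 1"
| "mersenne (Suc (Suc n)) = 3 * mersenne (Suc n) - 2 * mersenne n"

lemma mersenne_closed_form: "mersenne n = 2 ^ n - 1"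
  by (induction n rule: mersenne.induct) simp_all

text \<open>The division is the exact one of the field of rationals, so no divisibility is built into
  the definition. The notion is meant for \<open>k > 0\<close>; for \<open>k = 0\<close> the quotient is \<open>0\<close> by convention.\<close>

definition higher_mersenne :: "nat \<Rightarrow> nat \<Rightarrow> rat" where
  "higher_mersenne k n = of_int (mersenne (k * n)) / of_int (mersenne k)"

end

theory Submission
  imports Defs
begin

text \<open>By \<open>higher_mersenne_closed_form\<close>, with a = (2^k)^(n-r), b = (2^k)^r and d =
  2^k - 1, the terms at n-r, r, n, n+r are a-1, b-1, ab-1, ab^2-1, each over d. The claim is thus a
  polynomial identity in a and b: on the left a^2 b^2 and 1 cancel, leaving -a + 2ab - ab^2 =
  -a(b-1)^2.\<close>

lemma higher_mersenne_closed_form: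
  "higher_mersenne k n = ((2 ^ k) ^ n - 1) / (2 ^ k - 1)"
  by (simp add: higher_mersenne_def mersenne_closed_form power_mult)

theorem theorem2p8:
  fixes k n r :: nat
  assumes "k > 0" and "n \<ge> r"
  shows "higher_mersenne k (n - r) * higher_mersenne k (n + r) - (higher_mersenne k n)\<^sup>2
         = - ((2 ^ k) ^ (n - r) * (higher_mersenne k r)\<^sup>2)"
proof -
  \<comment> \<open>Writing n = m + r removes the truncated subtraction, so \<open>power_add\<close>
    can split all powers into \<open>a\<close> and \<open>b\<close>.\<close>
  define m where "m = n - r"
  have n: "n = m + r"
    using assms(2) by (simp add: m_def)
  define a b d :: rat where "a = (2 ^ k) ^ m" and "b = (2 ^ k) ^ r" and "d = 2 ^ k - 1"
  have H: "higher_mersenne k m = (a - 1) / d" "higher_mersenne k r = (b - 1) / d"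
    "higher_mersenne k (m + r) = (a * b - 1) / d"
    "higher_mersenne k (m + r + r) = (a * b * b - 1) / d"
    by (simp_all only: higher_mersenne_closed_form a_def b_def d_def power_add)
  have "(a - 1) * (a * b * b - 1) - (a * b - 1)\<^sup>2 = - (a * (b - 1)\<^sup>2)"
    by (simp add: power2_eq_square algebra_simps)
  \<comment> \<open>Both sides are quadratic in the numerators: this is the previous identity over
    \<open>d * d\<close>.\<close>
  then have "(a - 1) / d * ((a * b * b - 1) / d) - ((a * b - 1) / d)\<^sup>2 = - (a * ((b - 1) / d)\<^sup>2)"
    by (simp add: power2_eq_square flip: diff_divide_distrib)
  then show ?thesis
    by (simp add: n H flip: a_def)
qed

end
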